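(* Let $X$ be a real-valued random variable with cumulative distribution function $F(x):=P(X<x)$, $x\in\mathbb{R}$. Assume that $F$ is continuous and strictly increasing on $\mathbb{R}$, and that for every $\delta>1$ one has either $$\lim_{x\to\infty}\frac{1-F(\delta x)}{1-F(x)}=0\qquad\text{or}\qquad \lim_{x\to-\infty}\frac{F(\delta x)}{F(x)}=0 .$$ Let $\mu_1,\mu_2\in\mathbb{R}$ and $\sigma_1,\sigma_2>0$. If $\mathrm{Law}(h(\sigma_1X+\mu_1))=\mathrm{Law}(h(\sigma_2X+\mu_2))$, then $\sigma_1=\sigma_2$ and $\mu_1=\mu_2$.
   Context: $h:\mathbb{R}\to\mathbb{Z}$ is the integer part function: $h(x)=k$ for $x\in[k,k+1)$, $k\in\mathbb{Z}$. $\mathrm{Law}(Y)$ denotes the probability distribution of the random variable $Y$. *)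

theory Defs
  imports "HOL-Probability.Probability"
begin

(* The distribution function is taken with the strict inequality, F(x) = P(X < x); the
   library's cdf (distr M borel X) is P(X \<le> x) instead. *)
definition strict_cdf :: "'a measure \<Rightarrow> ('a \<Rightarrow> real) \<Rightarrow> real \<Rightarrow> real" where
  "strict_cdf M X x = measure M {\<omega> \<in> space M. X \<omega> < x}"

(* Law of an integer-valued random variable; the integers carry the discrete sigma-algebra. *)
definition int_law :: "'a measure \<Rightarrow> ('a \<Rightarrow> int) \<Rightarrow> int measure" where
  "int_law M Y = distr M (count_space UNIV) Y"

end

theory Submission
  imports Defs
begin

text \<open>
  The rounded variable \<open>\<lfloor>\<sigma> * X + \<mu>\<rfloor>\<close> is below an integer \<open>k\<close> exactly when
  \<open>X < (k - \<mu>) / \<sigma>\<close>, so its law determines the values of \<open>F\<close> at the points of the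
  arithmetic progression \<open>(k - \<mu>) / \<sigma>\<close>. An injective \<open>F\<close> turns equality of these values into
  equality of the two progressions, index by index. The common gap between consecutive
  points is \<open>1 / \<sigma>\<close>, and the point of index \<open>0\<close> is \<open>- \<mu> / \<sigma>\<close>; together they determine
  \<open>\<sigma>\<close> and \<open>\<mu>\<close>.
\<close>

text \<open>
  Rounding down preserves strict upper bounds by integers. This is where the convention
  \<open>F(x) = P(X < x)\<close> fits the half-open cells \<open>[k, k + 1)\<close>: no boundary term
  appears.
\<close>
lemma measure_int_law_floor_affine_lessThan:
  fixes X :: "'a \<Rightarrow> real" and \<mu> \<sigma> :: real
  assumes X: "X \<in> borel_measurable M" and "\<sigma> > 0"
  shows "measure (int_law M (\<lambda>\<omega>. \<lfloor>\<sigma> * X \<omega> + \<mu>\<rfloor>)) {..<k} = strict_cdf M X ((k - \<mu>) / \<sigma>)"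
proof -
  have floor_measurable: "(\<lambda>\<omega>. \<lfloor>\<sigma> * X \<omega> + \<mu>\<rfloor>) \<in> measurable M (count_space UNIV)"
    using X by measurable
  have "(\<lambda>\<omega>. \<lfloor>\<sigma> * X \<omega> + \<mu>\<rfloor>) -` {..<k} \<inter> space M = {\<omega> \<in> space M. X \<omega> < (k - \<mu>) / \<sigma>}"
    using \<open>\<sigma> > 0\<close> by (auto simp: floor_less_iff field_simps)
  then show ?thesis
    by (simp add: int_law_def strict_cdf_def measure_distr[OF floor_measurable])
qed

lemma affine_progression_inject:
  fixes \<mu>1 \<mu>2 \<sigma>1 \<sigma>2 :: real
  assumes "\<sigma>1 > 0" and "\<sigma>2 > 0"
    and eq: "\<And>k::int. (k - \<mu>1) / \<sigma>1 = (k - \<mu>2) / \<sigma>2"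
  shows "\<sigma>1 = \<sigma>2 \<and> \<mu>1 = \<mu>2"
proof -
  have "1 / \<sigma>1 = 1 / \<sigma>2"
    using eq[of 0] eq[of 1] by (simp add: diff_divide_distrib)
  then have "\<sigma>1 = \<sigma>2"
    by simp
  with eq[of 0] \<open>\<sigma>1 > 0\<close> show ?thesis
    by simp
qed

theorem theorem2p6:
  fixes M :: "'a measure" and X :: "'a \<Rightarrow> real" and F :: "real \<Rightarrow> real"
    and \<mu>1 \<mu>2 \<sigma>1 \<sigma>2 :: real
  assumes "prob_space M"
    and "X \<in> borel_measurable M"
    and "F = strict_cdf M X"
    and "continuous_on UNIV F"
    and "strict_mono F"
    and "\<And>\<delta>::real. \<delta> > 1 \<Longrightarrow>
           ((\<lambda>x. (1 - F (\<delta> * x)) / (1 - F x)) \<longlongrightarrow> 0) at_top \<or>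
           ((\<lambda>x. F (\<delta> * x) / F x) \<longlongrightarrow> 0) at_bot"
    and "\<sigma>1 > 0" and "\<sigma>2 > 0"
    and "int_law M (\<lambda>\<omega>. \<lfloor>\<sigma>1 * X \<omega> + \<mu>1\<rfloor>) = int_law M (\<lambda>\<omega>. \<lfloor>\<sigma>2 * X \<omega> + \<mu>2\<rfloor>)"
  shows "\<sigma>1 = \<sigma>2 \<and> \<mu>1 = \<mu>2"
proof (rule affine_progression_inject[OF assms(7,8)])
  fix k :: int
  have "F ((k - \<mu>1) / \<sigma>1) = F ((k - \<mu>2) / \<sigma>2)"
    using assms(2,3,7,8,9) by (metis measure_int_law_floor_affine_lessThan)
  then show "(k - \<mu>1) / \<sigma>1 = (k - \<mu>2) / \<sigma>2"
    using strict_mono_eq[OF assms(5)] by blast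
qed

end
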